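(* Let $\ell\in\frac12\mathbb{N}$ and let $W$ be the $(2\ell+1)\times(2\ell+1)$ matrix weight on $[-1,1]$ defined in the context. Then $$\det\bigl(W(x)\bigr)=(1-x^2)^{2(\ell+\frac12)^2}\prod_{k=0}^{2\ell}c_k(\ell),\qquad c_k(\ell)=\frac{4^k(k!)^4(2k+1)}{((2k+1)!)^2}\,\frac{(2\ell+k+1)!\,(2\ell-k)!}{((2\ell)!)^2}.$$
   Context: $\mathbb{N}=\{0,1,2,\dots\}$; rows and columns of $(2\ell+1)\times(2\ell+1)$ matrices are indexed by $0,1,\dots,2\ell$; $(a)_k=a(a+1)\cdots(a+k-1)$, $(a)_0=1$. $U_r$ is the Chebyshev polynomial of the second kind. The weight is, for $0\le m\le n\le 2\ell$ and $x\in[-1,1]$, $$W(x)_{n,m}=\sqrt{1-x^2}\sum_{t=0}^m\alpha_t(m,n)\,U_{n+m-2t}(x),$$ $$\alpha_t(m,n)=\frac{2\ell+1}{n+1}\,\frac{(2\ell-m)!\,m!}{(2\ell)!}\,(-1)^{m-t}\,\frac{(n-2\ell)_{m-t}}{(n+2)_{m-t}}\,\frac{(2\ell+2-t)_t}{t!},$$ and $W(x)_{n,m}=W(x)_{m,n}$ for $n<m$. *)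

theory Defs
  imports
    Complex_Main
    "HOL-Computational_Algebra.Polynomial"
    "Jordan_Normal_Form.Determinant"
begin

text \<open>
  Half-integers \<open>\<ell>\<close> are represented by the natural number \<open>N = 2\<ell>\<close>,
  so that the matrices have size \<open>N + 1\<close>. The matrices of Jordan_Normal_Form are
  indexed from 0.
\<close>

text \<open>Chebyshev polynomials of the second kind.\<close>

fun cheb_U :: "nat \<Rightarrow> real poly" where
  "cheb_U 0 = 1"
| "cheb_U (Suc 0) = [:0, 2:]"
| "cheb_U (Suc (Suc r)) = [:0, 2:] * cheb_U (Suc r) - cheb_U r"

text \<open>Only used for \<open>t \<le> m \<le> n \<le> N\<close>, where no subtraction on \<open>nat\<close> truncates.\<close>

definition weight_coeff :: "nat \<Rightarrow> nat \<Rightarrow> nat \<Rightarrow> nat \<Rightarrow> real" where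
  "weight_coeff N t m n =
     (real N + 1) / (real n + 1)
     * ((fact (N - m) * fact m) / fact N)
     * (-1) ^ (m - t)
     * (pochhammer (real n - real N) (m - t) / pochhammer (real n + 2) (m - t))
     * (pochhammer (real N + 2 - real t) t / fact t)"

text \<open>The row index is \<open>n\<close> and the column index is \<open>m\<close>; this formula is for \<open>m \<le> n\<close>.\<close>

definition weight_entry :: "nat \<Rightarrow> real \<Rightarrow> nat \<Rightarrow> nat \<Rightarrow> real" where
  "weight_entry N x n m =
     sqrt (1 - x\<^sup>2) * (\<Sum>t=0..m. weight_coeff N t m n * poly (cheb_U (n + m - 2 * t)) x)"

definition weight_mat :: "nat \<Rightarrow> real \<Rightarrow> real mat" where
  "weight_mat N x = mat (N + 1) (N + 1)
     (\<lambda>(n, m). if m \<le> n then weight_entry N x n m else weight_entry N x m n)"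

definition det_coeff :: "nat \<Rightarrow> nat \<Rightarrow> real" where
  "det_coeff N k =
     (4 ^ k * fact k ^ 4 * (2 * real k + 1)) / (fact (2 * k + 1))\<^sup>2
     * ((fact (N + k + 1) * fact (N - k)) / (fact N)\<^sup>2)"

end

theory Submission
  imports Defs
begin

text \<open>
  Write \<open>s = 1 - x\<^sup>2\<close>. The Pochhammer symbols in the coefficients regroup into binomial
  coefficients (\<open>weight_coeff_binomial\<close>), so that for \<open>m \<le> n\<close> the entry \<open>(n, m)\<close> of the
  weight is \<open>sqrt s / ((N choose n) (N choose m))\<close> times
    \<open>H n m = (\<Sum>t\<le>m. (N + 1 choose t) (N + 1 choose n + m + 1 - t) U (n + m - 2 t))\<close>.
  Let \<open>a\<close> and \<open>b\<close> be the numbers \<open>x \<plusminus> \<i> sqrt s\<close>. Since \<open>(a - b) U r = a ^ (r + 1) - b ^ (r + 1)\<close>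
  and \<open>a b = 1\<close>, the matrix \<open>H\<close> is, up to the factor \<open>a - b\<close>, the Bezoutian of
  \<open>(1 + a y) ^ (N + 1)\<close> and \<open>(1 + b y) ^ (N + 1)\<close>: the numbers \<open>(a - b) H n m\<close> are the
  coefficients of \<open>y ^ n z ^ m\<close> in
    \<open>((1 + a y) ^ (N + 1) (1 + b z) ^ (N + 1) - (1 + b y) ^ (N + 1) (1 + a z) ^ (N + 1)) / (y - z)\<close>.

  The numerator is a difference \<open>p ^ (N + 1) - q ^ (N + 1)\<close> with \<open>p = (1 + a y) (1 + b z)\<close>,
  \<open>q = (1 + b y) (1 + a z)\<close> and \<open>p - q = (a - b) (y - z)\<close>. Hence the quotient is
  \<open>(a - b) (\<Sum>i\<le>N. p ^ i q ^ (N - i))\<close>, in which the variables separate: \<open>H\<close> is the product of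
  the matrix of coefficients of the polynomials \<open>(1 + a y) ^ i (1 + b y) ^ (N - i)\<close> and the
  transpose of the same matrix with \<open>a\<close> and \<open>b\<close> exchanged (\<open>bezout_entry_explicit\<close>).

  Writing \<open>1 + a y = (1 + b y) + (a - b) y\<close> splits such a coefficient matrix into a lower and an
  upper triangular one, and gives it the determinant \<open>(\<Prod>n\<le>N. (a - b) ^ n)\<close>
  (\<open>det_lin_prod_mat\<close>). As \<open>(a - b) (b - a) = 4 s\<close>, the determinant of the weight is the product
  of the factors \<open>sqrt s (4 s) ^ n / (N choose n)\<^sup>2\<close> (\<open>det_weight_mat\<close>). The powers of \<open>s\<close> add up
  to the stated exponent, and the remaining constants have the same product as the
  \<open>det_coeff N k\<close> (\<open>prod_det_coeff\<close>), although the individual factors differ.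
\<close>

section \<open>The coefficients as products of binomial coefficients\<close>

lemma pochhammer_eq_fact_times_binomial:
  assumes "k \<le> n"
  shows "pochhammer (real n - real k + 1) k = fact k * real (n choose k)"
  using gbinomial_pochhammer'[of "real n" k] by (simp add: binomial_gbinomial)

text \<open>
  Both sides are \<open>n + 1\<close> times the number of pairs of nested subsets of sizes \<open>n + 1\<close> and
  \<open>n + 1 + k\<close> in a set of size \<open>N + 1\<close>. The vanishing for
  \<open>n + k > N\<close> mirrors the vanishing of \<open>pochhammer (n - N) k\<close>.
\<close>

lemma absorb_two_binomials:
  "(N + 1) * (N choose n) * ((N - n) choose k)
     = (n + 1) * ((n + 1 + k) choose k) * ((N + 1) choose (n + 1 + k))"
proof (cases "n + k \<le> N")
  case True
  have "(N + 1) * (N choose n) = (n + 1) * ((N + 1) choose (n + 1))"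
    using Suc_times_binomial_eq[of N n] by simp
  moreover have "((N + 1) choose (n + 1)) * ((N - n) choose k)
      = ((N + 1) choose (n + 1 + k)) * ((n + 1 + k) choose (n + 1))"
    using choose_mult[of "n + 1" "n + 1 + k" "N + 1"] True by simp
  moreover have "(n + 1 + k) choose (n + 1) = (n + 1 + k) choose k"
    using binomial_symmetric[of k "n + 1 + k"] by simp
  ultimately show ?thesis
    by (metis mult.assoc mult.commute)
next
  case False
  then show ?thesis by (cases "n \<le> N") (auto simp: binomial_eq_0)
qed

lemma weight_coeff_binomial:
  assumes "t \<le> m" "m \<le> n" "n \<le> N"
  shows "weight_coeff N t m n
    = real ((N + 1) choose t) * real ((N + 1) choose (n + m + 1 - t))
        / (real (N choose n) * real (N choose m))"
proof -
  define k where "k = m - t"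
  have idx: "n + m + 1 - t = n + 1 + k" using assms by (simp add: k_def)
  have m_part: "(fact (N - m) * fact m) / (fact N :: real) = 1 / real (N choose m)"
    using binomial_fact[of m N, where 'a = real] assms by (simp add: field_simps)
  have t_part: "pochhammer (real N + 2 - real t) t / fact t = real ((N + 1) choose t)"
    using pochhammer_eq_fact_times_binomial[of t "N + 1"] assms by (simp add: algebra_simps)
  have num: "(-1) ^ k * pochhammer (real n - real N) k = fact k * real ((N - n) choose k)"
  proof -
    have "pochhammer (real n - real N) k = pochhammer (- real (N - n)) k"
      using assms by (simp add: of_nat_diff)
    also have "\<dots> = (-1) ^ k * (fact k * real ((N - n) choose k))"
      using gbinomial_pochhammer[of "real (N - n)" k]
      by (simp add: binomial_gbinomial field_simps)
    finally show ?thesis by (simp flip: mult.assoc power_mult_distrib)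
  qed
  have den: "pochhammer (real n + 2) k = fact k * real ((n + 1 + k) choose k)"
    using pochhammer_eq_fact_times_binomial[of k "n + 1 + k"] by (simp add: algebra_simps)
  have absorb: "(real N + 1) * real (N choose n) * real ((N - n) choose k)
     = (real n + 1) * real ((n + 1 + k) choose k) * real ((N + 1) choose (n + 1 + k))"
    using arg_cong[OF absorb_two_binomials[of N n k], of real]
    by (simp only: of_nat_mult of_nat_add of_nat_1)
  have pos: "real (N choose n) \<noteq> 0" "real ((n + 1 + k) choose k) \<noteq> 0"
    using assms by (auto simp: binomial_eq_0_iff)
  have "weight_coeff N t m n
      = (real N + 1) / (real n + 1) * (1 / real (N choose m))
        * (((-1) ^ k * pochhammer (real n - real N) k) / pochhammer (real n + 2) k)
        * real ((N + 1) choose t)"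
    unfolding weight_coeff_def m_part t_part k_def[symmetric] by simp
  also have "\<dots> = (real N + 1) / (real n + 1) * (1 / real (N choose m))
        * (real ((N - n) choose k) / real ((n + 1 + k) choose k)) * real ((N + 1) choose t)"
    unfolding num den by simp
  also have "\<dots> = ((real N + 1) * real (N choose n) * real ((N - n) choose k))
        * (1 / real (N choose m)) * real ((N + 1) choose t)
        / ((real n + 1) * real ((n + 1 + k) choose k) * real (N choose n))"
    using pos by (simp add: divide_simps)
  also have "\<dots> = real ((N + 1) choose t) * real ((N + 1) choose (n + 1 + k))
        / (real (N choose n) * real (N choose m))"
  proof -
    have "real n + 1 \<noteq> 0" by simp
    then show ?thesis unfolding absorb using pos by (simp add: divide_simps)
  qed
  finally show ?thesis by (simp only: idx)
qed

section \<open>The Bezoutian of two powers of linear polynomials\<close>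

text \<open>
  The Bezoutian is a sum of products \<open>f y * g z\<close> in which \<open>f\<close> and \<open>g\<close> are polynomials
  \<open>(1 + a y) ^ i (1 + b y) ^ (N - i)\<close>; exchanging \<open>a\<close> and \<open>b\<close> amounts to reversing \<open>i\<close>.
\<close>

definition lin_prod :: "'a::comm_ring_1 \<Rightarrow> 'a \<Rightarrow> nat \<Rightarrow> nat \<Rightarrow> 'a poly" where
  "lin_prod a b N i = [:1, a:] ^ i * [:1, b:] ^ (N - i)"

lemma lin_prod_swap: "i \<le> N \<Longrightarrow> lin_prod a b N (N - i) = lin_prod b a N i"
  by (simp add: lin_prod_def mult.commute)

lemma lin_prod_Suc_left: "lin_prod a b (Suc N) (Suc i) = [:1, a:] * lin_prod a b N i"
  by (simp add: lin_prod_def algebra_simps)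

lemma lin_prod_Suc_right: "i \<le> N \<Longrightarrow> lin_prod a b (Suc N) i = [:1, b:] * lin_prod a b N i"
  by (simp add: lin_prod_def Suc_diff_le algebra_simps)

lemma coeff_linear_mult:
  "coeff ([:1, a:] * p) n = coeff p n + a * (if n = 0 then 0 else coeff p (n - 1))"
  for a :: "'a::comm_ring_1"
  by (cases n) (simp_all add: mult_pCons_left)

lemma coeff_linear_power: "coeff ([:1, a:] ^ n) k = of_nat (n choose k) * a ^ k"
  for a :: "'a::comm_ring_1"
proof (induction n arbitrary: k)
  case 0
  then show ?case by (cases k) auto
next
  case (Suc n)
  show ?case
    by (cases k) (simp_all add: coeff_linear_mult Suc.IH algebra_simps del: mult_pCons_left)
qed

text \<open>
  The coefficient of \<open>y ^ n z ^ m\<close> in the Bezoutian of \<open>(1 + a y) ^ (N + 1)\<close> and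
  \<open>(1 + b y) ^ (N + 1)\<close>, divided by \<open>a - b\<close>. Taking the separated form as the definition makes
  it meaningful also for \<open>a = b\<close>.
\<close>

definition bezout_entry :: "'a::comm_ring_1 \<Rightarrow> 'a \<Rightarrow> nat \<Rightarrow> nat \<Rightarrow> nat \<Rightarrow> 'a" where
  "bezout_entry a b N n m
     = (\<Sum>i\<le>N. coeff (lin_prod a b N i) n * coeff (lin_prod b a N i) m)"

lemma bezout_entry_commute: "bezout_entry a b N n m = bezout_entry a b N m n"
proof -
  have "bezout_entry a b N n m
      = (\<Sum>i\<le>N. coeff (lin_prod a b N (N - i)) n * coeff (lin_prod b a N (N - i)) m)"
    using sum.nat_diff_reindex[of _ "Suc N", symmetric]
    by (simp add: bezout_entry_def lessThan_Suc_atMost)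
  also have "\<dots> = bezout_entry a b N m n"
    unfolding bezout_entry_def by (intro sum.cong) (auto simp: lin_prod_swap mult.commute)
  finally show ?thesis .
qed

text \<open>
  Multiplication of the Bezoutian by \<open>y - z\<close>, compared at \<open>y ^ (n + 1) z ^ m\<close>. Passing from \<open>i\<close>
  to \<open>i + 1\<close> replaces a factor \<open>(1 + b y) (1 + a z)\<close> by \<open>(1 + a y) (1 + b z)\<close>, which changes
  the product by \<open>(a - b) (y - z)\<close> times the other factors, so the sum over \<open>i\<close> telescopes.
\<close>

lemma bezout_entry_step:
  fixes a b :: "'a::comm_ring_1"
  shows "(a - b) * (bezout_entry a b N n m
           - (if m = 0 then 0 else bezout_entry a b N (Suc n) (m - 1)))
    = of_nat (Suc N choose Suc n) * of_nat (Suc N choose m)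
        * (a ^ Suc n * b ^ m - b ^ Suc n * a ^ m)"
proof -
  define E where "E i = coeff (lin_prod a b (Suc N) i) (Suc n) * coeff (lin_prod b a (Suc N) i) m"
    for i
  define F where "F i k = coeff (lin_prod a b N i) k" for i k
  define F' where "F' i k = coeff (lin_prod b a N i) k" for i k
  have step: "E (Suc i) - E i
      = (a - b) * (F i n * F' i m - (if m = 0 then 0 else F i (Suc n) * F' i (m - 1)))"
    if "i \<le> N" for i
    using that unfolding E_def F_def F'_def
    by (simp add: lin_prod_Suc_left lin_prod_Suc_right coeff_linear_mult algebra_simps
        del: mult_pCons_left)
  have "(a - b) * (bezout_entry a b N n m
           - (if m = 0 then 0 else bezout_entry a b N (Suc n) (m - 1)))
      = (\<Sum>i\<le>N. E (Suc i) - E i)"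
    by (cases "m = 0")
      (simp_all add: step bezout_entry_def F_def F'_def sum_distrib_left
        flip: sum_subtractf)
  also have "\<dots> = E (Suc N) - E 0"
    using sum_lessThan_telescope[of E "Suc N"] by (simp add: lessThan_Suc_atMost)
  also have "\<dots> = of_nat (Suc N choose Suc n) * of_nat (Suc N choose m)
        * (a ^ Suc n * b ^ m - b ^ Suc n * a ^ m)"
    unfolding E_def lin_prod_def by (simp add: coeff_linear_power algebra_simps del: power_Suc binomial_Suc_Suc)
  finally show ?thesis .
qed

text \<open>
  The previous identity relates neighbours on the antidiagonal of \<open>(n, m)\<close>; summing it down to
  column \<open>0\<close> determines the entry.
\<close>

lemma bezout_entry_explicit:
  fixes a b :: "'a::comm_ring_1"
  shows "(a - b) * bezout_entry a b N n m
    = (\<Sum>t\<le>m. of_nat (Suc N choose (n + m + 1 - t)) * of_nat (Suc N choose t)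
        * (a ^ (n + m + 1 - t) * b ^ t - b ^ (n + m + 1 - t) * a ^ t))"
proof (induction m arbitrary: n)
  case 0
  show ?case using bezout_entry_step[of a b N n 0] by simp
next
  case (Suc m)
  have "(a - b) * bezout_entry a b N n (Suc m)
      = (a - b) * bezout_entry a b N (Suc n) m
        + of_nat (Suc N choose Suc n) * of_nat (Suc N choose Suc m)
          * (a ^ Suc n * b ^ Suc m - b ^ Suc n * a ^ Suc m)"
    using bezout_entry_step[of a b N n "Suc m"] by (simp add: algebra_simps)
  then show ?case
    by (simp add: Suc.IH del: power_Suc binomial_Suc_Suc)
qed

section \<open>The determinant of the change of basis\<close>

text \<open>
  The binomial theorem for \<open>1 + a y = (1 + b y) + (a - b) y\<close>. The polynomials
  \<open>y ^ k (1 + b y) ^ (N - k)\<close> start at \<open>y ^ k\<close> with coefficient \<open>1\<close>, and \<open>(i choose k)\<close> vanishes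
  for \<open>k > i\<close>: this is the triangular factorization.
\<close>

lemma lin_prod_expand:
  fixes a b :: "'a::comm_ring_1"
  assumes "i \<le> N"
  shows "lin_prod a b N i
    = (\<Sum>k\<le>N. smult ((a - b) ^ k * of_nat (i choose k)) (monom 1 k * [:1, b:] ^ (N - k)))"
proof -
  have split: "[:1, a:] = smult (a - b) (monom 1 1) + [:1, b:]"
    by (simp add: monom_altdef)
  have "lin_prod a b N i = (\<Sum>k\<le>i. of_nat (i choose k)
      * (smult (a - b) (monom 1 1)) ^ k * [:1, b:] ^ (i - k)) * [:1, b:] ^ (N - i)"
    unfolding lin_prod_def split by (subst binomial_ring) (rule refl)
  also have "\<dots> = (\<Sum>k\<le>i. smult ((a - b) ^ k * of_nat (i choose k))
      (monom 1 k * [:1, b:] ^ (N - k)))"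
    unfolding sum_distrib_right
  proof (intro sum.cong refl)
    fix k assume "k \<in> {..i}"
    then have "[:1, b:] ^ (N - k) = [:1, b:] ^ (i - k) * [:1, b:] ^ (N - i)"
      using assms by (simp flip: power_add)
    then show "of_nat (i choose k) * smult (a - b) (monom 1 1) ^ k * [:1, b:] ^ (i - k)
        * [:1, b:] ^ (N - i)
      = smult ((a - b) ^ k * of_nat (i choose k)) (monom 1 k * [:1, b:] ^ (N - k))"
      by (simp add: smult_power monom_power of_nat_poly mult_ac)
  qed
  also have "\<dots> = (\<Sum>k\<le>N. smult ((a - b) ^ k * of_nat (i choose k))
      (monom 1 k * [:1, b:] ^ (N - k)))"
    using assms by (intro sum.mono_neutral_left) (auto simp: binomial_eq_0)
  finally show ?thesis .
qed

text \<open>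
  The row scaling \<open>d\<close> absorbs the factors that distinguish the weight from the Bezoutian.
\<close>

definition lin_prod_mat :: "(nat \<Rightarrow> 'a::comm_ring_1) \<Rightarrow> 'a \<Rightarrow> 'a \<Rightarrow> nat \<Rightarrow> 'a mat" where
  "lin_prod_mat d a b N = mat (N + 1) (N + 1) (\<lambda>(n, i). d n * coeff (lin_prod a b N i) n)"

lemma det_lin_prod_mat:
  fixes a b :: "'a::idom"
  shows "det (lin_prod_mat d a b N) = (\<Prod>n=0..N. d n * (a - b) ^ n)"
proof -
  define L where "L = mat (N + 1) (N + 1)
    (\<lambda>(n, k). d n * coeff (monom 1 k * [:1, b:] ^ (N - k)) n)"
  define R where "R = mat (N + 1) (N + 1) (\<lambda>(k, i). (a - b) ^ k * of_nat (i choose k))"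
  have carr: "L \<in> carrier_mat (N + 1) (N + 1)" "R \<in> carrier_mat (N + 1) (N + 1)"
    by (simp_all add: L_def R_def)
  have "lin_prod_mat d a b N = L * R"
  proof (rule eq_matI)
    fix n i assume "n < dim_row (L * R)" "i < dim_col (L * R)"
    then have *: "n \<le> N" "i \<le> N" by (simp_all add: L_def R_def)
    have "(L * R) $$ (n, i)
        = (\<Sum>k\<le>N. d n * coeff (monom 1 k * [:1, b:] ^ (N - k)) n
            * ((a - b) ^ k * of_nat (i choose k)))"
      using * by (simp add: L_def R_def scalar_prod_def atLeast0LessThan lessThan_Suc_atMost
          del: sum.lessThan_Suc sum.atMost_Suc)
    then show "lin_prod_mat d a b N $$ (n, i) = (L * R) $$ (n, i)"
      using * by (simp add: lin_prod_mat_def lin_prod_expand coeff_sum sum_distrib_left mult_ac)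
  qed (simp_all add: lin_prod_mat_def L_def R_def)
  moreover have "det L = (\<Prod>n=0..N. d n)"
  proof -
    have "det L = prod_list (diag_mat L)"
      by (rule det_lower_triangular[OF _ carr(1)]) (simp add: L_def coeff_monom_mult)
    also have "\<dots> = (\<Prod>n=0..N. L $$ (n, n))"
      using carr by (simp add: prod_list_diag_prod atLeastLessThanSuc_atLeastAtMost)
    also have "\<dots> = (\<Prod>n=0..N. d n)"
      by (intro prod.cong) (auto simp: L_def coeff_monom_mult coeff_linear_power)
    finally show ?thesis .
  qed
  moreover have "det R = (\<Prod>n=0..N. (a - b) ^ n)"
  proof -
    have "det R = prod_list (diag_mat R)"
      by (rule det_upper_triangular[OF _ carr(2)]) (auto simp: R_def upper_triangular_def binomial_eq_0)
    also have "\<dots> = (\<Prod>n=0..N. R $$ (n, n))"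
      using carr by (simp add: prod_list_diag_prod atLeastLessThanSuc_atLeastAtMost)
    also have "\<dots> = (\<Prod>n=0..N. (a - b) ^ n)"
      by (intro prod.cong) (auto simp: R_def)
    finally show ?thesis .
  qed
  ultimately show ?thesis
    using det_mult[OF carr] by (simp add: prod.distrib)
qed

section \<open>Factorization of the weight\<close>

text \<open>
  The form \<open>U r (cos \<theta>) = sin ((r + 1) \<theta>) / sin \<theta>\<close> of the Chebyshev polynomials, with
  \<open>exp (\<plusminus> \<i> \<theta>)\<close> as \<open>a\<close> and \<open>b\<close>.
\<close>

lemma cheb_U_diff_powers:
  fixes a b :: complex
  assumes "a + b = 2 * of_real x" "a * b = 1"
  shows "(a - b) * of_real (poly (cheb_U r) x) = a ^ Suc r - b ^ Suc r"
proof (induction r rule: cheb_U.induct)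
  case 2
  have "(a - b) * of_real (poly (cheb_U (Suc 0)) x) = (a - b) * (a + b)"
    by (simp add: assms(1))
  then show ?case by (simp add: algebra_simps)
next
  case (3 r)
  have "(a - b) * of_real (poly (cheb_U (Suc (Suc r))) x)
      = (a + b) * ((a - b) * of_real (poly (cheb_U (Suc r)) x))
        - (a * b) * ((a - b) * of_real (poly (cheb_U r) x))"
    unfolding assms by (simp add: algebra_simps)
  also have "\<dots> = a ^ Suc (Suc (Suc r)) - b ^ Suc (Suc (Suc r))"
    unfolding 3 by (simp add: algebra_simps)
  finally show ?case .
qed simp

lemma weight_entry_bezout:
  fixes a b :: complex
  assumes ab: "a + b = 2 * of_real x" "a * b = 1" and "a \<noteq> b"
    and le: "m \<le> n" "n \<le> N"
  shows "of_real (weight_entry N x n m)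
    = of_real (sqrt (1 - x\<^sup>2) / (real (N choose n) * real (N choose m))) * bezout_entry a b N n m"
proof -
  define H where "H = (\<Sum>t\<le>m. of_nat (Suc N choose (n + m + 1 - t)) * of_nat (Suc N choose t)
      * (of_real (poly (cheb_U (n + m - 2 * t)) x) :: complex))"
  have "(a - b) * bezout_entry a b N n m = (a - b) * H"
    unfolding bezout_entry_explicit H_def sum_distrib_left
  proof (intro sum.cong refl)
    fix t assume "t \<in> {..m}"
    then have t: "t \<le> m" by simp
    have "a ^ (n + m + 1 - t) * b ^ t - b ^ (n + m + 1 - t) * a ^ t
        = (a * b) ^ t * (a ^ Suc (n + m - 2 * t) - b ^ Suc (n + m - 2 * t))"
    proof -
      have "n + m + 1 - t = t + Suc (n + m - 2 * t)" using t le by simp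
      then show ?thesis by (simp only: power_add power_mult_distrib) (simp add: algebra_simps)
    qed
    then have key: "a ^ (n + m + 1 - t) * b ^ t - b ^ (n + m + 1 - t) * a ^ t
        = (a - b) * of_real (poly (cheb_U (n + m - 2 * t)) x)"
      using cheb_U_diff_powers[OF ab] ab(2) by simp
    show "of_nat (Suc N choose (n + m + 1 - t)) * of_nat (Suc N choose t)
        * (a ^ (n + m + 1 - t) * b ^ t - b ^ (n + m + 1 - t) * a ^ t)
      = (a - b) * (of_nat (Suc N choose (n + m + 1 - t)) * of_nat (Suc N choose t)
        * of_real (poly (cheb_U (n + m - 2 * t)) x))"
      unfolding key by (simp only: mult_ac)
  qed
  then have H: "bezout_entry a b N n m = H" using \<open>a \<noteq> b\<close> by simp
  have "weight_entry N x n m = sqrt (1 - x\<^sup>2) / (real (N choose n) * real (N choose m))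
      * (\<Sum>t\<le>m. real (Suc N choose (n + m + 1 - t)) * real (Suc N choose t)
        * poly (cheb_U (n + m - 2 * t)) x)"
    unfolding weight_entry_def sum_distrib_left atMost_atLeast0
    by (intro sum.cong refl) (simp add: weight_coeff_binomial le del: binomial_Suc_Suc)
  then show ?thesis unfolding H H_def by (simp del: binomial_Suc_Suc)
qed

lemma det_weight_mat:
  assumes "x\<^sup>2 \<le> 1"
  shows "det (weight_mat N x)
    = (\<Prod>n=0..N. sqrt (1 - x\<^sup>2) / (real (N choose n))\<^sup>2 * (4 * (1 - x\<^sup>2)) ^ n)"
proof -
  define s where "s = 1 - x\<^sup>2"
  define a where "a = Complex x (sqrt s)"
  define b where "b = Complex x (- sqrt s)"
  define d where "d n = complex_of_real (sqrt s / real (N choose n))" for n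
  define e where "e n = complex_of_real (1 / real (N choose n))" for n
  have s: "s \<ge> 0" using assms by (simp add: s_def)
  have ab: "a + b = 2 * of_real x" "a * b = 1"
    using s by (simp_all add: a_def b_def complex_eq_iff) (simp add: s_def power2_eq_square)
  have disc: "(a - b) * (b - a) = complex_of_real (4 * s)"
    using s by (simp add: a_def b_def complex_eq_iff)
  \<comment> \<open>At the end points \<open>a = b\<close>, but there both sides carry the factor \<open>sqrt s = 0\<close>.\<close>
  have entry: "complex_of_real (weight_entry N x n m) = d n * e m * bezout_entry a b N n m"
    if "m \<le> n" "n \<le> N" for n m
  proof (cases "s = 0")
    case True
    then show ?thesis by (simp add: weight_entry_def d_def flip: s_def)
  next
    case False
    then have "a \<noteq> b" using s by (simp add: a_def b_def)
    then show ?thesis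
      using weight_entry_bezout[OF ab _ that] by (simp add: d_def e_def s_def)
  qed
  have "map_mat complex_of_real (weight_mat N x)
      = lin_prod_mat d a b N * transpose_mat (lin_prod_mat e b a N)" (is "?W = ?A * ?B")
  proof (rule eq_matI)
    fix n m assume "n < dim_row (?A * ?B)" "m < dim_col (?A * ?B)"
    then have nm: "n \<le> N" "m \<le> N" by (simp_all add: lin_prod_mat_def)
    then have "(?A * ?B) $$ (n, m) = d n * e m * bezout_entry a b N n m"
      by (simp add: lin_prod_mat_def scalar_prod_def bezout_entry_def sum_distrib_left mult_ac
          atLeast0LessThan lessThan_Suc_atMost del: sum.lessThan_Suc sum.atMost_Suc)
    moreover have "?W $$ (n, m) = d n * e m * bezout_entry a b N n m"
    proof (cases "m \<le> n")
      case True
      then show ?thesis using nm entry by (simp add: weight_mat_def)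
    next
      case False
      then have "?W $$ (n, m) = d m * e n * bezout_entry a b N m n"
        using nm entry by (simp add: weight_mat_def)
      then show ?thesis
        by (subst bezout_entry_commute) (simp add: d_def e_def)
    qed
    ultimately show "?W $$ (n, m) = (?A * ?B) $$ (n, m)" by simp
  qed (simp_all add: lin_prod_mat_def weight_mat_def)
  then have "complex_of_real (det (weight_mat N x)) = det (?A * ?B)"
    using of_real_hom.hom_det[of "weight_mat N x", where 'a = complex] by simp
  also have "\<dots> = det (lin_prod_mat d a b N) * det (lin_prod_mat e b a N)"
    by (subst det_mult[of _ "N + 1"]) (simp_all add: lin_prod_mat_def det_transpose[of _ "N + 1"])
  also have "\<dots> = (\<Prod>n=0..N. d n * e n * ((a - b) * (b - a)) ^ n)"
    by (simp add: det_lin_prod_mat power_mult_distrib mult_ac flip: prod.distrib)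
  also have "\<dots> = complex_of_real (\<Prod>n=0..N. sqrt s / (real (N choose n))\<^sup>2 * (4 * s) ^ n)"
    unfolding disc of_real_prod by (intro prod.cong) (simp_all add: d_def e_def power2_eq_square)
  finally show ?thesis unfolding of_real_eq_iff s_def .
qed

section \<open>The constants\<close>

lemma prod_fact_shift:
  "(\<Prod>k=0..Suc N. fact (Suc N + k + 1) :: real) * fact (Suc N)
     = (\<Prod>k=0..N. fact (N + k + 1)) * fact (2 * N + 2) * fact (2 * N + 3)"
proof -
  have "(\<Prod>k=0..Suc N. fact (Suc N + k + 1) :: real) * fact (Suc N)
      = fact (N + 0 + 1) * (\<Prod>k=0..Suc N. fact (N + Suc k + 1))"
    by (simp add: mult.commute)
  also have "\<dots> = (\<Prod>k=0..Suc (Suc N). fact (N + k + 1))"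
    by (rule prod.atLeast0_atMost_Suc_shift[symmetric, unfolded comp_def])
  also have "\<dots> = (\<Prod>k=0..N. fact (N + k + 1)) * fact (2 * N + 2) * fact (2 * N + 3)"
    by (simp add: numeral_eq_Suc mult_2 del: fact_Suc)
  finally show ?thesis .
qed

text \<open>
  After cancelling the squared binomial coefficients this is the comparison of the two products
  of constants. It holds only for the whole product, by induction on \<open>N\<close>: all the factorials
  \<open>fact (N + k + 1)\<close> change with \<open>N\<close>, but by a shift of the index.
\<close>

lemma prod_fact_quotient:
  "(\<Prod>k=0..N. fact k * (2 * real k + 1) * fact (N + k + 1) / (fact (2 * k + 1))\<^sup>2) = 1"
proof (induction N)
  case 0
  show ?case by simp
next
  case (Suc N)
  define g where "g k = fact k * (2 * real k + 1) / (fact (2 * k + 1))\<^sup>2" for k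
  have split: "(\<Prod>k=0..M. fact k * (2 * real k + 1) * fact (M + k + 1) / (fact (2 * k + 1))\<^sup>2)
      = (\<Prod>k=0..M. g k) * (\<Prod>k=0..M. fact (M + k + 1))" for M
    by (simp add: g_def flip: prod.distrib)
  have "fact (2 * N + 3) = (2 * real N + 3) * fact (2 * N + 2)"
    using fact_Suc[of "2 * N + 2", where 'a = real] by (simp add: algebra_simps numeral_3_eq_3 del: fact_Suc)
  then have new: "g (Suc N) * fact (2 * N + 2) * fact (2 * N + 3) = fact (Suc N)"
  proof -
    have "2 * Suc N + 1 = 2 * N + 3" "2 * real (Suc N) + 1 = 2 * real N + 3" by simp_all
    then have "g (Suc N) * fact (2 * N + 2) * fact (2 * N + 3)
        = fact (Suc N) * ((2 * real N + 3) * fact (2 * N + 2)) * fact (2 * N + 3)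
          / (fact (2 * N + 3))\<^sup>2"
      unfolding g_def by (simp only: times_divide_eq_left times_divide_eq_right mult_ac)
    also have "\<dots> = fact (Suc N)"
      unfolding \<open>fact (2 * N + 3) = (2 * real N + 3) * fact (2 * N + 2)\<close>[symmetric]
      by (simp add: power2_eq_square del: fact_Suc)
    finally show ?thesis .
  qed
  have "(\<Prod>k=0..Suc N. g k) * (\<Prod>k=0..Suc N. fact (Suc N + k + 1)) * fact (Suc N)
      = (\<Prod>k=0..N. g k) * g (Suc N)
        * ((\<Prod>k=0..Suc N. fact (Suc N + k + 1)) * fact (Suc N))"
    by simp
  also have "\<dots> = ((\<Prod>k=0..N. g k) * (\<Prod>k=0..N. fact (N + k + 1)))
        * (g (Suc N) * fact (2 * N + 2) * fact (2 * N + 3))"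
    unfolding prod_fact_shift by (simp only: mult_ac)
  also have "\<dots> = fact (Suc N)"
    unfolding new using Suc.IH by (simp only: split mult_1)
  finally show ?case unfolding split by simp
qed

lemma prod_det_coeff:
  "(\<Prod>k=0..N. det_coeff N k) = (\<Prod>k=0..N. 4 ^ k / (real (N choose k))\<^sup>2)"
proof -
  define q where
    "q k = fact k * (2 * real k + 1) * fact (N + k + 1) / (fact (2 * k + 1))\<^sup>2" for k
  \<comment> \<open>The factors match only after reversing the order of \<open>fact (N - k)\<close>.\<close>
  have "det_coeff N k * fact (N - k) = 4 ^ k / (real (N choose k))\<^sup>2 * q k * fact k"
    if "k \<in> {0..N}" for k
    using that unfolding det_coeff_def q_def
    by (simp add: binomial_fact field_simps power2_eq_square power4_eq_xxxx del: fact_Suc)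
  then have "(\<Prod>k=0..N. det_coeff N k * fact (N - k))
      = (\<Prod>k=0..N. 4 ^ k / (real (N choose k))\<^sup>2 * q k * fact k)"
    by (rule prod.cong[OF refl])
  then have "(\<Prod>k=0..N. det_coeff N k) * (\<Prod>k=0..N. fact (N - k))
      = (\<Prod>k=0..N. 4 ^ k / (real (N choose k))\<^sup>2) * (\<Prod>k=0..N. q k) * (\<Prod>k=0..N. fact k)"
    by (simp only: prod.distrib)
  moreover have "(\<Prod>k=0..N. q k) = 1"
    unfolding q_def by (rule prod_fact_quotient)
  moreover have "(\<Prod>k=0..N. fact (N - k)) = (\<Prod>k=0..N. fact k :: real)"
    using prod.atLeastAtMost_rev[of "\<lambda>k. fact k :: real" 0 N] by simp
  ultimately show ?thesis by simp
qed

lemma prod_sqrt_power: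
  assumes "s \<ge> 0"
  shows "(\<Prod>n=0..N. sqrt s * s ^ n) = s powr ((real N + 1)\<^sup>2 / 2)"
proof (cases "s = 0")
  case True
  then show ?thesis by (simp add: prod.atLeast0_atMost_Suc_shift)
next
  case False
  then have s: "s > 0" using assms by simp
  have "(\<Prod>n=0..N. sqrt s * s ^ n) = (\<Prod>n=0..N. s powr (1 / 2 + real n))"
    using s by (simp add: powr_add powr_realpow powr_half_sqrt)
  also have "\<dots> = s powr (\<Sum>n=0..N. 1 / 2 + real n)"
    using s by (simp add: powr_sum)
  also have "(\<Sum>n=0..N. 1 / 2 + real n) = (real N + 1)\<^sup>2 / 2"
    by (induction N) (simp_all add: power2_eq_square field_simps)
  finally show ?thesis .
qed

theorem corollary2p3:
  fixes l x :: real and N :: nat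
  assumes "2 * l = real N"
    and "x \<in> {-1..1}"
  shows "det (weight_mat N x)
           = (1 - x\<^sup>2) powr (2 * (l + 1 / 2)\<^sup>2) * (\<Prod>k=0..N. det_coeff N k)"
proof -
  have x: "x\<^sup>2 \<le> 1" using assms(2) by (simp add: abs_square_le_1 abs_le_iff)
  have l: "2 * (l + 1 / 2)\<^sup>2 = (real N + 1)\<^sup>2 / 2"
    unfolding assms(1)[symmetric] by (simp add: power2_eq_square field_simps)
  have "det (weight_mat N x)
      = (\<Prod>n=0..N. (sqrt (1 - x\<^sup>2) * (1 - x\<^sup>2) ^ n) * (4 ^ n / (real (N choose n))\<^sup>2))"
    unfolding det_weight_mat[OF x] power_mult_distrib by (simp add: mult_ac)
  also have "\<dots> = (\<Prod>n=0..N. sqrt (1 - x\<^sup>2) * (1 - x\<^sup>2) ^ n)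
      * (\<Prod>k=0..N. 4 ^ k / (real (N choose k))\<^sup>2)"
    by (rule prod.distrib)
  also have "\<dots> = (1 - x\<^sup>2) powr (2 * (l + 1 / 2)\<^sup>2) * (\<Prod>k=0..N. det_coeff N k)"
    using x by (simp only: prod_sqrt_power l prod_det_coeff diff_ge_0_iff_ge)
  finally show ?thesis .
qed

end
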